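(* Let $f\in\mathbb{R}[z_1,\ldots,z_n]$ be of degree $d$ and let $f_H\in\mathbb{R}[z_1,\ldots,z_{n+1}]$ be the (unique) homogeneous polynomial of degree $d$ such that $f_H(z_1,\ldots,z_n,1)=f(z_1,\ldots,z_n)$. Then $f$ is real stable if and only if $f_H$ is hyperbolic with respect to every vector $v\in\mathbb{R}^{n+1}$ such that $v_{n+1}=0$ and $v_i>0$ for $1\le i\le n$.
   Context: A polynomial $f\in\mathbb{C}[z_1,\ldots,z_n]$ is stable if $f(z_1,\ldots,z_n)\neq 0$ for all $(z_1,\ldots,z_n)\in\mathbb{C}^n$ with $\operatorname{Im}(z_j)>0$ for $1\le j\le n$; it is real stable if in addition it has real coefficients. A homogeneous polynomial $p\in\mathbb{R}[z_1,\ldots,z_m]$ is (Gårding) hyperbolic with respect to $v\in\mathbb{R}^m$ if $p(v)\neq 0$ and for all $\alpha\in\mathbb{R}^m$ the univariate polynomial $p(\alpha+vt)\in\mathbb{R}[t]$ has only real zeros. *)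

theory Defs
  imports
    Complex_Main
    "HOL-Library.Poly_Mapping"
    "HOL-Computational_Algebra.Polynomial"
begin

section \<open>Multivariate polynomials\<close>

text \<open>
  Variables are indexed from \<open>0\<close>: \<open>z\<^sub>1, \<dots>, z\<^sub>n\<close> are the variables
  \<open>0, \<dots>, n - 1\<close>, and the homogenizing variable \<open>z\<^bsub>n+1\<^esub>\<close> is the variable \<open>n\<close>.
  The multiplication of \<^typ>\<open>(nat \<Rightarrow>\<^sub>0 nat) \<Rightarrow>\<^sub>0 'a::comm_ring_1\<close> is
  convolution over the monoid of exponent vectors, i.e. polynomial multiplication.

  A point of \<open>n\<close>-dimensional space is a function on \<^typ>\<open>nat\<close> of which only the
  coordinates \<open>0, \<dots>, n - 1\<close> matter, since polynomials in \<open>mpolys n\<close> do not see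
  the others.
\<close>

type_synonym 'a mpoly = "(nat \<Rightarrow>\<^sub>0 nat) \<Rightarrow>\<^sub>0 'a"

definition mpolys :: "nat \<Rightarrow> 'a::zero mpoly set" where
  "mpolys n = {p. \<forall>m\<in>Poly_Mapping.keys p. Poly_Mapping.keys m \<subseteq> {..<n}}"

definition mvar :: "nat \<Rightarrow> 'a::zero_neq_one mpoly" where
  "mvar i = Poly_Mapping.single (Poly_Mapping.single i 1) 1"

definition mdegree :: "(nat \<Rightarrow>\<^sub>0 nat) \<Rightarrow> nat" where
  "mdegree m = (\<Sum>i\<in>Poly_Mapping.keys m. Poly_Mapping.lookup m i)"

text \<open>The zero polynomial gets total degree \<open>0\<close>.\<close>

definition total_degree :: "'a::zero mpoly \<Rightarrow> nat" where
  "total_degree p = Max (insert 0 (mdegree ` Poly_Mapping.keys p))"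

definition homogeneous :: "nat \<Rightarrow> 'a::zero mpoly \<Rightarrow> bool" where
  "homogeneous d p \<longleftrightarrow> (\<forall>m\<in>Poly_Mapping.keys p. mdegree m = d)"

text \<open>
  Substitution of \<open>x i\<close> for the variable \<open>i\<close>, where \<open>h\<close> embeds the coefficients
  into the target ring (the identity for ordinary evaluation, the constant polynomials
  when polynomials are substituted for the variables).
\<close>

definition mpoly_subst ::
    "('a::zero \<Rightarrow> 'b::comm_semiring_1) \<Rightarrow> (nat \<Rightarrow> 'b) \<Rightarrow> 'a mpoly \<Rightarrow> 'b" where
  "mpoly_subst h x p =
     (\<Sum>m\<in>Poly_Mapping.keys p.
        h (Poly_Mapping.lookup p m) *
        (\<Prod>i\<in>Poly_Mapping.keys m. x i ^ Poly_Mapping.lookup m i))"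

abbreviation mpoly_eval :: "'a::comm_semiring_1 mpoly \<Rightarrow> (nat \<Rightarrow> 'a) \<Rightarrow> 'a" where
  "mpoly_eval p x \<equiv> mpoly_subst (\<lambda>c. c) x p"


section \<open>Stability and hyperbolicity\<close>

definition stable :: "nat \<Rightarrow> complex mpoly \<Rightarrow> bool" where
  "stable n f \<longleftrightarrow> (\<forall>z. (\<forall>j<n. Im (z j) > 0) \<longrightarrow> mpoly_eval f z \<noteq> 0)"

definition real_stable :: "nat \<Rightarrow> complex mpoly \<Rightarrow> bool" where
  "real_stable n f \<longleftrightarrow> stable n f \<and> (\<forall>m. Poly_Mapping.lookup f m \<in> \<real>)"

definition complex_mpoly :: "real mpoly \<Rightarrow> complex mpoly" where
  "complex_mpoly p = Poly_Mapping.map complex_of_real p"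

definition only_real_zeros :: "real poly \<Rightarrow> bool" where
  "only_real_zeros q \<longleftrightarrow>
     (\<forall>t::complex. poly (map_poly complex_of_real q) t = 0 \<longrightarrow> t \<in> \<real>)"

text \<open>The univariate polynomial \<open>p(\<alpha> + v t)\<close> in \<open>t\<close>.\<close>

definition line_restriction ::
    "real mpoly \<Rightarrow> (nat \<Rightarrow> real) \<Rightarrow> (nat \<Rightarrow> real) \<Rightarrow> real poly" where
  "line_restriction p \<alpha> v = mpoly_subst (\<lambda>c. [:c:]) (\<lambda>i. [:\<alpha> i, v i:]) p"

definition hyperbolic :: "real mpoly \<Rightarrow> (nat \<Rightarrow> real) \<Rightarrow> bool" where
  "hyperbolic p v \<longleftrightarrow>
     (\<exists>d. homogeneous d p) \<and> mpoly_eval p v \<noteq> 0 \<and>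
     (\<forall>\<alpha>. only_real_zeros (line_restriction p \<alpha> v))"


section \<open>Homogenization\<close>

text \<open>The last conjunct is the polynomial identity \<open>g(z\<^sub>1, \<dots>, z\<^sub>n, 1) = f\<close>.\<close>

definition is_homogenization ::
    "nat \<Rightarrow> nat \<Rightarrow> 'a::comm_ring_1 mpoly \<Rightarrow> 'a mpoly \<Rightarrow> bool" where
  "is_homogenization n d f g \<longleftrightarrow>
     g \<in> mpolys (Suc n) \<and> homogeneous d g \<and>
     mpoly_subst (Poly_Mapping.single 0) (\<lambda>i. if i < n then mvar i else 1) g = f"

definition restrict_exponents :: "nat \<Rightarrow> (nat \<Rightarrow>\<^sub>0 nat) \<Rightarrow> (nat \<Rightarrow>\<^sub>0 nat)" where
  "restrict_exponents n m =
     (\<Sum>i\<in>Poly_Mapping.keys m.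
        if i < n then Poly_Mapping.single i (Poly_Mapping.lookup m i) else 0)"

lemma lookup_restrict_exponents:
  "Poly_Mapping.lookup (restrict_exponents n m) j =
     (if j < n then Poly_Mapping.lookup m j else 0)"
proof -
  have "Poly_Mapping.lookup (restrict_exponents n m) j =
      (\<Sum>i\<in>Poly_Mapping.keys m. if i = j then (if j < n then Poly_Mapping.lookup m j else 0) else 0)"
    unfolding restrict_exponents_def lookup_sum
    by (rule sum.cong) (auto simp: lookup_single when_def)
  also have "\<dots> = (if j < n then Poly_Mapping.lookup m j else 0)"
    by (simp add: in_keys_iff)
  finally show ?thesis .
qed

lemma mvar_power: "(mvar i :: 'a::comm_ring_1 mpoly) ^ k = Poly_Mapping.single (Poly_Mapping.single i k) 1"
  by (induction k) (simp_all add: mvar_def mult_single flip: single_add)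

lemma prod_single_one:
  "finite A \<Longrightarrow> (\<Prod>i\<in>A. Poly_Mapping.single (e i) (1::'a::comm_ring_1)) =
     Poly_Mapping.single (\<Sum>i\<in>A. e i :: nat \<Rightarrow>\<^sub>0 nat) 1"
  by (induction A rule: finite_induct) (simp_all add: mult_single)

lemma dehomogenize_monomial:
  "(\<Prod>i\<in>Poly_Mapping.keys m. (if i < n then mvar i else 1) ^ Poly_Mapping.lookup m i) =
     (Poly_Mapping.single (restrict_exponents n m) 1 :: 'a::comm_ring_1 mpoly)"
proof -
  have "(\<Prod>i\<in>Poly_Mapping.keys m. (if i < n then mvar i else 1) ^ Poly_Mapping.lookup m i) =
      (\<Prod>i\<in>Poly_Mapping.keys m. Poly_Mapping.single
        (if i < n then Poly_Mapping.single i (Poly_Mapping.lookup m i) else 0) (1::'a))"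
    by (rule prod.cong) (auto simp: mvar_power)
  then show ?thesis
    by (simp add: prod_single_one restrict_exponents_def)
qed

lemma lookup_dehomogenize:
  fixes g :: "'a::comm_ring_1 mpoly"
  shows "Poly_Mapping.lookup
      (mpoly_subst (Poly_Mapping.single 0) (\<lambda>i. if i < n then mvar i else 1) g) k =
    (\<Sum>m\<in>Poly_Mapping.keys g. if restrict_exponents n m = k then Poly_Mapping.lookup g m else 0)"
  unfolding mpoly_subst_def dehomogenize_monomial lookup_sum
  by (rule sum.cong) (auto simp: mult_single lookup_single when_def)

lemma mdegree_eq:
  assumes "Poly_Mapping.keys m \<subseteq> {..<n}"
  shows "mdegree m = (\<Sum>i<n. Poly_Mapping.lookup m i)"
  unfolding mdegree_def using assms
  by (intro sum.mono_neutral_left) (auto simp: in_keys_iff)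

lemma mdegree_restrict_exponents:
  assumes "Poly_Mapping.keys m \<subseteq> {..<Suc n}"
  shows "mdegree m = mdegree (restrict_exponents n m) + Poly_Mapping.lookup m n"
proof -
  have "Poly_Mapping.keys (restrict_exponents n m) \<subseteq> {..<n}"
    by (auto simp: in_keys_iff lookup_restrict_exponents split: if_splits)
  then show ?thesis
    using assms by (simp add: mdegree_eq[of _ n] mdegree_eq[of m "Suc n"] lookup_restrict_exponents)
qed

text \<open>Undoes \<^const>\<open>restrict_exponents\<close> on the monomials of degree \<open>d\<close>.\<close>

definition extend_exponents :: "nat \<Rightarrow> nat \<Rightarrow> (nat \<Rightarrow>\<^sub>0 nat) \<Rightarrow> (nat \<Rightarrow>\<^sub>0 nat)" where
  "extend_exponents n d k = k + Poly_Mapping.single n (d - mdegree k)"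

lemma extend_restrict_exponents:
  assumes "Poly_Mapping.keys m \<subseteq> {..<Suc n}" "mdegree m = d"
  shows "extend_exponents n d (restrict_exponents n m) = m"
proof (rule poly_mapping_eqI)
  fix j
  show "Poly_Mapping.lookup (extend_exponents n d (restrict_exponents n m)) j =
      Poly_Mapping.lookup m j"
    using assms mdegree_restrict_exponents[OF assms(1)]
    by (auto simp: extend_exponents_def lookup_add lookup_single lookup_restrict_exponents
        when_def in_keys_iff subset_iff)
qed

lemma restrict_extend_exponents:
  assumes "Poly_Mapping.keys k \<subseteq> {..<n}"
  shows "restrict_exponents n (extend_exponents n d k) = k"
proof (rule poly_mapping_eqI)
  fix j
  show "Poly_Mapping.lookup (restrict_exponents n (extend_exponents n d k)) j =
      Poly_Mapping.lookup k j"
    using assms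
    by (auto simp: extend_exponents_def lookup_add lookup_single lookup_restrict_exponents
        when_def in_keys_iff subset_iff)
qed

lemma keys_extend_exponents:
  assumes "Poly_Mapping.keys k \<subseteq> {..<n}"
  shows "Poly_Mapping.keys (extend_exponents n d k) \<subseteq> {..<Suc n}"
  using assms
  by (auto simp: extend_exponents_def lookup_add lookup_single when_def in_keys_iff subset_iff
      less_Suc_eq split: if_splits)

lemma mdegree_extend_exponents:
  assumes "Poly_Mapping.keys k \<subseteq> {..<n}" "mdegree k \<le> d"
  shows "mdegree (extend_exponents n d k) = d"
proof -
  have "n \<notin> Poly_Mapping.keys k"
    using assms(1) by auto
  then have "Poly_Mapping.lookup (extend_exponents n d k) n = d - mdegree k"
    by (simp add: extend_exponents_def lookup_add in_keys_iff)
  then show ?thesis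
    using mdegree_restrict_exponents[OF keys_extend_exponents[OF assms(1)], of d]
      restrict_extend_exponents[OF assms(1), of d] assms(2) by simp
qed

lemma lookup_is_homogenization:
  assumes "is_homogenization n d f g" "m \<in> Poly_Mapping.keys g"
  shows "Poly_Mapping.lookup f (restrict_exponents n m) = Poly_Mapping.lookup g m"
proof -
  have g: "Poly_Mapping.keys m' \<subseteq> {..<Suc n}" "mdegree m' = d" if "m' \<in> Poly_Mapping.keys g" for m'
    using assms(1) that by (auto simp: is_homogenization_def mpolys_def homogeneous_def)
  have "Poly_Mapping.lookup f (restrict_exponents n m) =
      (\<Sum>m'\<in>Poly_Mapping.keys g.
        if restrict_exponents n m' = restrict_exponents n m then Poly_Mapping.lookup g m' else 0)"
    using assms(1) by (auto simp: is_homogenization_def lookup_dehomogenize[symmetric])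
  also have "\<dots> = (\<Sum>m'\<in>Poly_Mapping.keys g. if m' = m then Poly_Mapping.lookup g m' else 0)"
    by (rule sum.cong[OF refl]) (metis assms(2) extend_restrict_exponents g)
  also have "\<dots> = Poly_Mapping.lookup g m"
    using assms(2) by simp
  finally show ?thesis .
qed

lemma is_homogenization_unique:
  assumes "is_homogenization n d f g" "is_homogenization n d f g'"
  shows "g = g'"
proof -
  have *: "m \<in> Poly_Mapping.keys g2 \<and> Poly_Mapping.lookup g2 m = Poly_Mapping.lookup g1 m"
    if h: "is_homogenization n d f g1" "is_homogenization n d f g2" "m \<in> Poly_Mapping.keys g1"
    for g1 g2 m
  proof -
    have g1: "Poly_Mapping.keys m \<subseteq> {..<Suc n}" "mdegree m = d"
      using h(1,3) by (auto simp: is_homogenization_def mpolys_def homogeneous_def)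
    have f: "Poly_Mapping.lookup f (restrict_exponents n m) \<noteq> 0"
      using lookup_is_homogenization[OF h(1,3)] h(3) by (simp add: in_keys_iff)
    have "Poly_Mapping.lookup f (restrict_exponents n m) =
      (\<Sum>m'\<in>Poly_Mapping.keys g2.
        if restrict_exponents n m' = restrict_exponents n m then Poly_Mapping.lookup g2 m' else 0)"
      using h(2) by (auto simp: is_homogenization_def lookup_dehomogenize[symmetric])
    with f obtain m' where m': "m' \<in> Poly_Mapping.keys g2"
        "restrict_exponents n m' = restrict_exponents n m"
      by (force elim!: sum.not_neutral_contains_not_neutral split: if_splits)
    then have "Poly_Mapping.keys m' \<subseteq> {..<Suc n}" "mdegree m' = d"
      using h(2) by (auto simp: is_homogenization_def mpolys_def homogeneous_def)
    with g1 m'(2) have "m' = m"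
      by (metis extend_restrict_exponents)
    then show ?thesis
      using m'(1) lookup_is_homogenization[OF h(1,3)] lookup_is_homogenization[OF h(2), of m] by simp
  qed
  show ?thesis
  proof (rule poly_mapping_eqI)
    fix m
    show "Poly_Mapping.lookup g m = Poly_Mapping.lookup g' m"
      using *[OF assms, of m] *[OF assms(2,1), of m] by (metis in_keys_iff)
  qed
qed

lemma mdegree_le_total_degree:
  "m \<in> Poly_Mapping.keys f \<Longrightarrow> mdegree m \<le> total_degree f"
  by (simp add: total_degree_def)

lemma is_homogenization_exists:
  fixes f :: "'a::comm_ring_1 mpoly"
  assumes "f \<in> mpolys n" "total_degree f \<le> d"
  shows "\<exists>g. is_homogenization n d f g"
proof -
  let ?c = "\<lambda>m. if Poly_Mapping.keys m \<subseteq> {..<Suc n} \<and> mdegree m = d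
      then Poly_Mapping.lookup f (restrict_exponents n m) else 0"
  define g where "g = Abs_poly_mapping ?c"
  have "{m. ?c m \<noteq> 0} \<subseteq> extend_exponents n d ` Poly_Mapping.keys f"
  proof
    fix m assume "m \<in> {m. ?c m \<noteq> 0}"
    then have "Poly_Mapping.keys m \<subseteq> {..<Suc n}" "mdegree m = d"
        "restrict_exponents n m \<in> Poly_Mapping.keys f"
      by (auto simp: in_keys_iff split: if_splits)
    then show "m \<in> extend_exponents n d ` Poly_Mapping.keys f"
      by (metis extend_restrict_exponents imageI)
  qed
  then have "finite {m. ?c m \<noteq> 0}"
    by (rule finite_subset) simp
  then have g: "Poly_Mapping.lookup g m = ?c m" for m
    by (simp add: g_def)
  have keys: "Poly_Mapping.keys m \<subseteq> {..<Suc n}" "mdegree m = d" if "m \<in> Poly_Mapping.keys g" for m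
    using that by (auto simp: in_keys_iff g split: if_splits)
  have "mpoly_subst (Poly_Mapping.single 0) (\<lambda>i. if i < n then mvar i else 1) g = f" (is "?D = f")
  proof (rule poly_mapping_eqI)
    fix k
    have D: "Poly_Mapping.lookup ?D k =
      (\<Sum>m\<in>Poly_Mapping.keys g. if restrict_exponents n m = k then Poly_Mapping.lookup g m else 0)"
      by (rule lookup_dehomogenize)
    show "Poly_Mapping.lookup ?D k = Poly_Mapping.lookup f k"
    proof (cases "k \<in> Poly_Mapping.keys f")
      case True
      then have k: "Poly_Mapping.keys k \<subseteq> {..<n}" "mdegree k \<le> d"
        using assms mdegree_le_total_degree[OF True] by (auto simp: mpolys_def)
      have gk: "Poly_Mapping.lookup g (extend_exponents n d k) = Poly_Mapping.lookup f k"
        using keys_extend_exponents[OF k(1)] mdegree_extend_exponents[OF k]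
          restrict_extend_exponents[OF k(1)] by (simp add: g)
      then have mem: "extend_exponents n d k \<in> Poly_Mapping.keys g"
        using True by (simp add: in_keys_iff)
      have "Poly_Mapping.lookup ?D k = (\<Sum>m\<in>Poly_Mapping.keys g.
          if m = extend_exponents n d k then Poly_Mapping.lookup g m else 0)"
        unfolding D
        by (rule sum.cong[OF refl]) (metis extend_restrict_exponents restrict_extend_exponents k(1) keys)
      then show ?thesis
        using mem gk by simp
    next
      case False
      then have f0: "Poly_Mapping.lookup f k = 0"
        by (simp add: in_keys_iff)
      show ?thesis
        unfolding D f0 by (rule sum.neutral) (auto simp: g f0)
    qed
  qed
  then show ?thesis
    using keys by (auto simp: is_homogenization_def mpolys_def homogeneous_def)
qed

theorem homogenization_ex1:
  fixes f :: "'a::comm_ring_1 mpoly"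
  assumes "f \<in> mpolys n" "total_degree f = d"
  shows "\<exists>!g. is_homogenization n d f g"
  using is_homogenization_exists[OF assms(1)] is_homogenization_unique assms(2) by blast

end

theory Submission
  imports Defs "HOL-Computational_Algebra.Fundamental_Theorem_Algebra"
begin

text \<open>
  A line \<open>\<alpha> + v t\<close> at \<open>t = \<i>\<close> is a point of the upper half-space whose last coordinate is real,
  so hyperbolicity gives stability by choosing \<open>\<alpha>\<^sub>n = 1\<close>. Conversely, for stable \<open>f\<close> homogeneity
  shows that \<open>f\<^sub>H\<close> has no zero with \<open>z\<close> in the upper half-space and last coordinate \<open>a > 0\<close>;
  letting \<open>a\<close> tend to \<open>0\<close> along a complex line on which the top-degree part of \<open>f\<close> does not vanish
  identically settles \<open>a = 0\<close>, and \<open>z \<mapsto> - cnj z\<close> settles \<open>a < 0\<close>. The case \<open>a = 0\<close> also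
  gives \<open>f\<^sub>H(v) \<noteq> 0\<close>, by evaluating at \<open>\<i> v\<close>.
\<close>

section \<open>Substitution into multivariate polynomials\<close>

text \<open>Stated for arbitrary semiring homomorphisms, since it serves for complex conjugation,
  for the embedding of the reals and for evaluation of univariate polynomials, over the same field
  or after lifting to the complex numbers.\<close>

lemma mpoly_subst_hom:
  fixes \<phi> :: "'b::comm_semiring_1 \<Rightarrow> 'c::comm_semiring_1"
  assumes add: "\<And>a b. \<phi> (a + b) = \<phi> a + \<phi> b" and mult: "\<And>a b. \<phi> (a * b) = \<phi> a * \<phi> b"
    and zero: "\<phi> 0 = 0" and one: "\<phi> 1 = 1"
  shows "\<phi> (mpoly_subst h x p) = mpoly_subst (\<lambda>c. \<phi> (h c)) (\<lambda>i. \<phi> (x i)) p"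
proof -
  have sum: "\<phi> (sum g A) = (\<Sum>a\<in>A. \<phi> (g a))" for g :: "(nat \<Rightarrow>\<^sub>0 nat) \<Rightarrow> 'b" and A
    by (induction A rule: infinite_finite_induct) (simp_all add: add zero)
  have prod: "\<phi> (prod g A) = (\<Prod>a\<in>A. \<phi> (g a))" for g :: "nat \<Rightarrow> 'b" and A
    by (induction A rule: infinite_finite_induct) (simp_all add: mult one)
  have pow: "\<phi> (a ^ k) = \<phi> a ^ k" for a k
    by (induction k) (simp_all add: mult one)
  show ?thesis
    by (simp add: mpoly_subst_def sum prod pow mult)
qed

lemma mpoly_eval_complex_mpoly:
  "mpoly_eval (complex_mpoly p) z = mpoly_subst complex_of_real z p"
proof -
  have l: "Poly_Mapping.lookup (complex_mpoly p) m = complex_of_real (Poly_Mapping.lookup p m)" for m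
    by (simp add: complex_mpoly_def map.rep_eq when_def)
  then have "Poly_Mapping.keys (complex_mpoly p) = Poly_Mapping.keys p"
    by (auto simp: in_keys_iff)
  with l show ?thesis
    by (simp add: mpoly_subst_def)
qed

lemma mpoly_subst_cong:
  assumes "p \<in> mpolys n" "\<And>i. i < n \<Longrightarrow> x i = y i"
  shows "mpoly_subst h x p = mpoly_subst h y p"
  unfolding mpoly_subst_def
proof (intro sum.cong refl arg_cong2[where f = "(*)"] prod.cong)
  fix m i assume "m \<in> Poly_Mapping.keys p" "i \<in> Poly_Mapping.keys m"
  then show "x i ^ Poly_Mapping.lookup m i = y i ^ Poly_Mapping.lookup m i"
    using assms by (auto simp: mpolys_def subset_iff)
qed

lemma mpoly_subst_scale:
  assumes "homogeneous d p"
  shows "mpoly_subst h (\<lambda>i. c * x i) p = c ^ d * mpoly_subst h x p"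
proof -
  have "(\<Prod>i\<in>Poly_Mapping.keys m. (c * x i) ^ Poly_Mapping.lookup m i) =
      c ^ d * (\<Prod>i\<in>Poly_Mapping.keys m. x i ^ Poly_Mapping.lookup m i)"
    if "m \<in> Poly_Mapping.keys p" for m
  proof -
    have "mdegree m = d"
      using assms that by (simp add: homogeneous_def)
    then show ?thesis
      by (simp add: power_mult_distrib prod.distrib mdegree_def flip: power_sum)
  qed
  then show ?thesis
    unfolding mpoly_subst_def sum_distrib_left
    by (intro sum.cong refl) (simp add: mult.left_commute)
qed

lemma mpoly_subst_cnj:
  "mpoly_subst complex_of_real (\<lambda>i. cnj (z i)) p = cnj (mpoly_subst complex_of_real z p)"
  using mpoly_subst_hom[of cnj complex_of_real z p] by simp

lemma poly_mpoly_subst: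
  "poly (mpoly_subst (\<lambda>c. [:h c:]) x p) t = mpoly_subst h (\<lambda>i. poly (x i) t) p"
  using mpoly_subst_hom[of "\<lambda>q. poly q t" "\<lambda>c. [:h c:]" x p] by simp

text \<open>Trades zeros of a univariate polynomial for zeros of \<open>p\<close> at complex points,
  the form in which stability is used. Lifting the coefficients and then evaluating at
  \<open>t\<close> is a ring homomorphism.\<close>

lemma poly_line_restriction:
  "poly (map_poly complex_of_real (line_restriction p \<alpha> v)) t =
     mpoly_subst complex_of_real (\<lambda>i. of_real (\<alpha> i) + t * of_real (v i)) p"
proof -
  have add: "map_poly complex_of_real (a + b) = map_poly of_real a + map_poly of_real b" for a b
    by (rule poly_eqI) (simp add: coeff_map_poly)
  have smult: "map_poly complex_of_real (smult c a) = smult (of_real c) (map_poly of_real a)" for c a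
    by (simp add: map_poly_smult)
  have "poly (map_poly complex_of_real (a * b)) t =
      poly (map_poly complex_of_real a) t * poly (map_poly complex_of_real b) t" for a b
    by (induction a) (simp_all add: map_poly_pCons add smult algebra_simps)
  then show ?thesis
    unfolding line_restriction_def
    by (subst mpoly_subst_hom[of "\<lambda>q. poly (map_poly complex_of_real q) t"])
      (simp_all add: add map_poly_pCons)
qed

text \<open>The bound depends only on \<open>d\<close>, so it holds uniformly for a family of lines
  and survives a limit.\<close>

lemma degree_mpoly_subst_le:
  fixes x :: "nat \<Rightarrow> 'b::comm_ring_1 poly"
  assumes "homogeneous d p" "\<And>i. degree (x i) \<le> 1"
  shows "degree (mpoly_subst (\<lambda>c. [:h c:]) x p) \<le> d"
  unfolding mpoly_subst_def
proof (rule degree_sum_le)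
  fix m assume "m \<in> Poly_Mapping.keys p"
  then have d: "mdegree m = d"
    using assms(1) by (simp add: homogeneous_def)
  have "degree (\<Prod>i\<in>Poly_Mapping.keys m. x i ^ Poly_Mapping.lookup m i) \<le>
      (\<Sum>i\<in>Poly_Mapping.keys m. degree (x i ^ Poly_Mapping.lookup m i))"
    using degree_prod_sum_le[of "Poly_Mapping.keys m" "\<lambda>i. x i ^ Poly_Mapping.lookup m i"] by (simp add: comp_def)
  also have "\<dots> \<le> (\<Sum>i\<in>Poly_Mapping.keys m. Poly_Mapping.lookup m i)"
  proof (rule sum_mono)
    fix i
    show "degree (x i ^ Poly_Mapping.lookup m i) \<le> Poly_Mapping.lookup m i"
      using degree_power_le[of "x i" "Poly_Mapping.lookup m i"]
        mult_le_mono1[OF assms(2)[of i], of "Poly_Mapping.lookup m i"] by linarith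
  qed
  finally have "degree (\<Prod>i\<in>Poly_Mapping.keys m. x i ^ Poly_Mapping.lookup m i) \<le> d"
    using d by (simp add: mdegree_def)
  then show "degree ([:h (Poly_Mapping.lookup p m):] *
      (\<Prod>i\<in>Poly_Mapping.keys m. x i ^ Poly_Mapping.lookup m i)) \<le> d"
    by (intro order.trans[OF degree_mult_le]) simp
qed simp

text \<open>Among monomials of the fixed degree \<open>d\<close> the exponent of variable
  \<open>n\<close> is determined by the others. Hence dehomogenizing merges no monomials and keeps
  every coefficient; the dropped powers of variable \<open>n\<close> take the value 1.\<close>

lemma mpoly_subst_dehomogenize:
  assumes "is_homogenization n d f g"
  shows "mpoly_subst h x f = mpoly_subst h (x(n := 1)) g"
proof -
  have keys: "Poly_Mapping.keys m \<subseteq> {..<Suc n}" "mdegree m = d" if "m \<in> Poly_Mapping.keys g" for m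
    using assms that by (auto simp: is_homogenization_def mpolys_def homogeneous_def)
  have inj: "inj_on (restrict_exponents n) (Poly_Mapping.keys g)"
    by (rule inj_onI) (metis extend_restrict_exponents keys)
  have "Poly_Mapping.keys f = restrict_exponents n ` Poly_Mapping.keys g"
  proof
    show "Poly_Mapping.keys f \<subseteq> restrict_exponents n ` Poly_Mapping.keys g"
    proof
      fix k assume "k \<in> Poly_Mapping.keys f"
      then have "(\<Sum>m\<in>Poly_Mapping.keys g.
          if restrict_exponents n m = k then Poly_Mapping.lookup g m else 0) \<noteq> 0"
        using assms by (auto simp: is_homogenization_def lookup_dehomogenize[symmetric] in_keys_iff)
      then show "k \<in> restrict_exponents n ` Poly_Mapping.keys g"
        by (force elim!: sum.not_neutral_contains_not_neutral split: if_splits)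
    qed
    show "restrict_exponents n ` Poly_Mapping.keys g \<subseteq> Poly_Mapping.keys f"
      using lookup_is_homogenization[OF assms] by (auto simp: in_keys_iff)
  qed
  then have "mpoly_subst h x f = (\<Sum>m\<in>Poly_Mapping.keys g. h (Poly_Mapping.lookup g m) *
      (\<Prod>i\<in>Poly_Mapping.keys (restrict_exponents n m).
        x i ^ Poly_Mapping.lookup (restrict_exponents n m) i))"
    using lookup_is_homogenization[OF assms] by (simp add: mpoly_subst_def sum.reindex[OF inj])
  also have "\<dots> = mpoly_subst h (x(n := 1)) g"
    unfolding mpoly_subst_def
  proof (intro sum.cong refl arg_cong2[where f = "(*)"] prod.mono_neutral_cong_left ballI)
    fix m i assume "m \<in> Poly_Mapping.keys g"
      "i \<in> Poly_Mapping.keys m - Poly_Mapping.keys (restrict_exponents n m)"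
    then have "i = n"
      using keys(1)[of m] by (auto simp: in_keys_iff lookup_restrict_exponents subset_iff less_Suc_eq
          split: if_splits)
    then show "(x(n := 1)) i ^ Poly_Mapping.lookup m i = 1"
      by simp
  qed (auto simp: in_keys_iff lookup_restrict_exponents split: if_splits)
  finally show ?thesis .
qed


section \<open>Nonvanishing points\<close>

lemma sum_digits_less:
  fixes a :: "nat \<Rightarrow> nat"
  assumes "\<And>i. i < n \<Longrightarrow> a i < B"
  shows "(\<Sum>i<n. a i * B ^ i) < B ^ n"
  using assms
proof (induction n)
  case (Suc n)
  have "(\<Sum>i<Suc n. a i * B ^ i) < B ^ n + a n * B ^ n"
    using Suc by simp
  also have "\<dots> = Suc (a n) * B ^ n"
    by simp
  also have "\<dots> \<le> B * B ^ n"
    using Suc.prems[of n] by (intro mult_le_mono1) simp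
  finally show ?case
    by simp
qed simp

lemma sum_digits_inject:
  fixes a b :: "nat \<Rightarrow> nat"
  assumes "\<And>i. i < n \<Longrightarrow> a i < B" "\<And>i. i < n \<Longrightarrow> b i < B"
    and "(\<Sum>i<n. a i * B ^ i) = (\<Sum>i<n. b i * B ^ i)" "i < n"
  shows "a i = b i"
  using assms
proof (induction n)
  case (Suc n)
  have lt: "(\<Sum>i<n. a i * B ^ i) < B ^ n" "(\<Sum>i<n. b i * B ^ i) < B ^ n"
    using Suc.prems by (auto intro!: sum_digits_less)
  have eq: "(\<Sum>i<n. a i * B ^ i) + a n * B ^ n = (\<Sum>i<n. b i * B ^ i) + b n * B ^ n"
    using Suc.prems by simp
  have "B > 0"
    using Suc.prems(1)[of n] by simp
  \<comment> \<open>The lower digits contribute less than \<open>B ^ n\<close>, so division by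
    \<open>B ^ n\<close> isolates the leading digit; the induction hypothesis handles the
    rest.\<close>
  from eq have "((\<Sum>i<n. a i * B ^ i) + a n * B ^ n) div B ^ n = ((\<Sum>i<n. b i * B ^ i) + b n * B ^ n) div B ^ n"
    by simp
  with \<open>B > 0\<close> lt have "a n = b n"
    by simp
  with eq Suc show ?case
    by (auto simp: less_Suc_eq)
qed simp

text \<open>Kronecker's substitution \<open>x\<^sub>i = t\<^bsup>B^i\<^esup>\<close> sends distinct monomials to distinct powers of \<open>t\<close>
  once \<open>B\<close> exceeds all exponents.\<close>

lemma monomial_sum_nonzero_ex:
  fixes c :: "(nat \<Rightarrow>\<^sub>0 nat) \<Rightarrow> 'a::{idom, ring_char_0}"
  assumes "finite S" "m0 \<in> S" "c m0 \<noteq> 0" and keys: "\<And>m. m \<in> S \<Longrightarrow> Poly_Mapping.keys m \<subseteq> {..<n}"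
  shows "\<exists>x. (\<Sum>m\<in>S. c m * (\<Prod>i\<in>Poly_Mapping.keys m. x i ^ Poly_Mapping.lookup m i)) \<noteq> 0"
proof -
  \<comment> \<open>An exponent is at most the degree of its monomial, hence at most the sum of all
    degrees.\<close>
  define B where "B = Suc (\<Sum>m\<in>S. mdegree m)"
  define N where "N m = (\<Sum>i<n. Poly_Mapping.lookup m i * B ^ i)" for m :: "nat \<Rightarrow>\<^sub>0 nat"
  define q where "q = (\<Sum>m\<in>S. monom (c m) (N m))"
  have B: "Poly_Mapping.lookup m i < B" if "m \<in> S" "i < n" for m i
  proof -
    have "Poly_Mapping.lookup m i \<le> mdegree m"
      using that(2) by (simp add: mdegree_eq[OF keys[OF that(1)]] member_le_sum)
    also have "\<dots> \<le> (\<Sum>m\<in>S. mdegree m)"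
      using assms(1) that by (simp add: member_le_sum)
    finally show ?thesis
      by (simp add: B_def)
  qed
  have inj: "m = m'" if m: "m \<in> S" "m' \<in> S" "N m = N m'" for m m'
  proof (rule poly_mapping_eqI)
    fix i
    show "Poly_Mapping.lookup m i = Poly_Mapping.lookup m' i"
    proof (cases "i < n")
      case True
      then show ?thesis
        using m B sum_digits_inject[of n "Poly_Mapping.lookup m" B "Poly_Mapping.lookup m'" i]
        by (simp add: N_def)
    next
      case False
      then show ?thesis
        using keys m by (metis in_keys_iff lessThan_iff subsetD)
    qed
  qed
  have "coeff q (N m0) = (\<Sum>m\<in>S. if m = m0 then c m else 0)"
    unfolding q_def coeff_sum using inj assms(2) by (intro sum.cong) auto
  also have "\<dots> = c m0"
    using assms(1,2) by simp
  finally have "q \<noteq> 0"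
    using assms(3) by auto
  then obtain t where t: "poly q t \<noteq> 0"
    using poly_all_0_iff_0 by blast
  have "poly q t = (\<Sum>m\<in>S. c m *
      (\<Prod>i\<in>Poly_Mapping.keys m. (t ^ (B ^ i)) ^ Poly_Mapping.lookup m i))"
    unfolding q_def poly_sum poly_monom
  proof (intro sum.cong refl arg_cong2[where f = "(*)"])
    fix m assume "m \<in> S"
    have "t ^ N m = (\<Prod>i<n. (t ^ (B ^ i)) ^ Poly_Mapping.lookup m i)"
      by (simp add: N_def power_sum power_mult [symmetric] mult.commute)
    also have "\<dots> = (\<Prod>i\<in>Poly_Mapping.keys m. (t ^ (B ^ i)) ^ Poly_Mapping.lookup m i)"
      using keys[OF \<open>m \<in> S\<close>] by (intro prod.mono_neutral_right) (auto simp: in_keys_iff)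
    finally show "t ^ N m = \<dots>" .
  qed
  with t show ?thesis
    by auto
qed

text \<open>On the hyperplane where coordinate \<open>n\<close> is 0, \<open>g\<close> agrees with
  the degree \<open>d\<close> part of \<open>f\<close>. This part is nonzero because
  \<open>d\<close> is the exact degree of \<open>f\<close>.\<close>

lemma homogenization_nonzero_at_infinity:
  fixes f :: "real mpoly"
  assumes "f \<in> mpolys n" "total_degree f = d" "is_homogenization n d f g" "f \<noteq> 0"
  shows "\<exists>x. x n = 0 \<and> mpoly_subst complex_of_real x g \<noteq> 0"
proof -
  define S where "S = {m \<in> Poly_Mapping.keys g. Poly_Mapping.lookup m n = 0}"
  have keys: "Poly_Mapping.keys m \<subseteq> {..<Suc n}" "mdegree m = d" if "m \<in> Poly_Mapping.keys g" for m
    using assms(3) that by (auto simp: is_homogenization_def mpolys_def homogeneous_def)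
  \<comment> \<open>The default 0 in \<open>total_degree\<close> is harmless: if it is the maximum,
    every monomial of the nonzero \<open>f\<close> has degree 0 and attains it.\<close>
  have "total_degree f \<in> mdegree ` Poly_Mapping.keys f"
  proof -
    have "total_degree f \<in> insert 0 (mdegree ` Poly_Mapping.keys f)"
      unfolding total_degree_def by (intro Max_in) auto
    moreover obtain k where "k \<in> Poly_Mapping.keys f"
      using assms(4) by fastforce
    ultimately show ?thesis
      using mdegree_le_total_degree[of k f] by force
  qed
  then obtain k where k: "k \<in> Poly_Mapping.keys f" "mdegree k = d"
    using assms(2) by auto
  then have "(\<Sum>m\<in>Poly_Mapping.keys g.
      if restrict_exponents n m = k then Poly_Mapping.lookup g m else 0) \<noteq> 0"
    using assms(3) by (auto simp: is_homogenization_def lookup_dehomogenize[symmetric] in_keys_iff)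
  then obtain m0 where m0: "m0 \<in> Poly_Mapping.keys g" "restrict_exponents n m0 = k"
    by (force elim!: sum.not_neutral_contains_not_neutral split: if_splits)
  then have "m0 \<in> S"
    using mdegree_restrict_exponents[OF keys(1)] keys(2) k by (simp add: S_def)
  then obtain x where x: "(\<Sum>m\<in>S. complex_of_real (Poly_Mapping.lookup g m) *
      (\<Prod>i\<in>Poly_Mapping.keys m. x i ^ Poly_Mapping.lookup m i)) \<noteq> 0"
    using monomial_sum_nonzero_ex[of S m0 "\<lambda>m. complex_of_real (Poly_Mapping.lookup g m)" "Suc n"]
      keys(1) m0(1) by (auto simp: S_def in_keys_iff)
  \<comment> \<open>Setting coordinate \<open>n\<close> to 0 kills the monomials outside
    \<open>S\<close>, while those in \<open>S\<close> do not see this coordinate.\<close>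
  have "mpoly_subst complex_of_real (x(n := 0)) g = (\<Sum>m\<in>S. complex_of_real (Poly_Mapping.lookup g m) *
      (\<Prod>i\<in>Poly_Mapping.keys m. x i ^ Poly_Mapping.lookup m i))"
    unfolding mpoly_subst_def
  proof (intro sum.mono_neutral_cong_right ballI)
    fix m assume "m \<in> Poly_Mapping.keys g - S"
    then have "n \<in> Poly_Mapping.keys m"
      by (auto simp: S_def in_keys_iff)
    then have "(\<Prod>i\<in>Poly_Mapping.keys m. (x(n := 0)) i ^ Poly_Mapping.lookup m i) = 0"
      by (intro prod_zero bexI[of _ n]) (auto simp: in_keys_iff)
    then show "complex_of_real (Poly_Mapping.lookup g m) *
        (\<Prod>i\<in>Poly_Mapping.keys m. (x(n := 0)) i ^ Poly_Mapping.lookup m i) = 0"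
      by simp
  next
    fix m assume "m \<in> S"
    then have "(\<Prod>i\<in>Poly_Mapping.keys m. (x(n := 0)) i ^ Poly_Mapping.lookup m i) =
        (\<Prod>i\<in>Poly_Mapping.keys m. x i ^ Poly_Mapping.lookup m i)"
      by (intro prod.cong) (auto simp: S_def)
    then show "complex_of_real (Poly_Mapping.lookup g m) *
        (\<Prod>i\<in>Poly_Mapping.keys m. (x(n := 0)) i ^ Poly_Mapping.lookup m i) =
      complex_of_real (Poly_Mapping.lookup g m) *
        (\<Prod>i\<in>Poly_Mapping.keys m. x i ^ Poly_Mapping.lookup m i)"
      by simp
  qed (auto simp: S_def)
  with x have "mpoly_subst complex_of_real (x(n := 0)) g \<noteq> 0"
    by simp
  then show ?thesis
    by (intro exI[of _ "x(n := 0)"]) simp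
qed


section \<open>Stability and the homogenization\<close>

text \<open>A quantitative substitute for Hurwitz' theorem: the bound survives limits of polynomials of
  bounded degree, so a limit of polynomials that are zero-free on the disc either vanishes
  identically or does not vanish at the centre.\<close>

lemma norm_poly_le_of_zero_free:
  fixes q :: "complex poly"
  assumes "r > 0" "degree q \<le> D" "\<And>s. norm s < r \<Longrightarrow> poly q s \<noteq> 0"
  shows "norm (poly q s) \<le> norm (poly q 0) * (1 + norm s / r) ^ D"
  using assms(2,3)
proof (induction D arbitrary: q)
  case 0
  then obtain c where "q = [:c:]"
    by (meson degree_eq_zeroE le_zero_eq)
  then show ?case
    by simp
next
  case (Suc D)
  have one: "1 \<le> 1 + norm s / r"
    using assms(1) by simp
  show ?case
  proof (cases "degree q = 0")
    case True
    then obtain c where "q = [:c:]"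
      by (meson degree_eq_zeroE)
    then show ?thesis
      using mult_left_mono[OF one_le_power[OF one, of "Suc D"], of "norm c"] by simp
  next
    case False
    then obtain z where z: "poly q z = 0"
      using fundamental_theorem_of_algebra[of q] by (auto simp: constant_degree)
    then obtain q' where q: "q = [:- z, 1:] * q'"
      by (auto simp: poly_eq_0_iff_dvd)
    have "q' \<noteq> 0"
      using False q by auto
    then have "degree q = Suc (degree q')"
      unfolding q by (subst degree_mult_eq) auto
    moreover have "poly q' t \<noteq> 0" if "norm t < r" for t
      using Suc.prems(2)[OF that] q by auto
    ultimately have IH: "norm (poly q' s) \<le> norm (poly q' 0) * (1 + norm s / r) ^ D"
      using Suc.prems(1) by (intro Suc.IH) auto
    \<comment> \<open>The zero \<open>z\<close> lies outside the open disc, so the factor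
      \<open>s - z\<close> grows from its size \<open>norm z\<close> at the centre by at most
      \<open>1 + norm s / r\<close>.\<close>
    have "r \<le> norm z"
      using Suc.prems(2)[of z] z by force
    then have "norm s \<le> norm z * (norm s / r)"
      using assms(1) mult_right_mono[of r "norm z" "norm s"] by (simp add: field_simps)
    then have lin: "norm (s - z) \<le> norm z * (1 + norm s / r)"
      using norm_triangle_ineq4[of s z] by (simp add: algebra_simps)
    have "norm (poly q s) = norm (s - z) * norm (poly q' s)"
      by (simp add: q norm_mult left_diff_distrib flip: norm_mult)
    also have "\<dots> \<le> (norm z * (1 + norm s / r)) * (norm (poly q' 0) * (1 + norm s / r) ^ D)"
      using assms(1) by (intro mult_mono lin IH) auto
    also have "\<dots> = norm (poly q 0) * (1 + norm s / r) ^ Suc D"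
      by (simp add: q norm_mult)
    finally show ?thesis .
  qed
qed

lemma homogenization_nonzero_upper:
  fixes f g :: "real mpoly"
  assumes f: "f \<in> mpolys n" "total_degree f = d" "is_homogenization n d f g"
    and stable: "stable n (complex_mpoly f)"
    and z: "\<And>j. j < n \<Longrightarrow> Im (z j) > 0" "z n = of_real a" "a \<ge> 0"
  shows "mpoly_subst complex_of_real z g \<noteq> 0"
proof -
  let ?F = "\<lambda>z. mpoly_subst complex_of_real z g"
  have g: "homogeneous d g"
    using f(3) by (simp add: is_homogenization_def)
  have pos: "?F z \<noteq> 0" if z: "\<And>j. j < n \<Longrightarrow> Im (z j) > 0" "z n = of_real a" "a > 0" for z a
  proof -
    \<comment> \<open>Division by the positive \<open>a\<close> keeps the first \<open>n\<close>
      coordinates in the upper half-plane and makes the last one 1, where \<open>g\<close> agrees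
      with \<open>f\<close>.\<close>
    define w where "w i = z i / of_real a" for i
    have "mpoly_subst complex_of_real w f \<noteq> 0"
      using stable z by (auto simp: stable_def mpoly_eval_complex_mpoly w_def)
    moreover have "w(n := 1) = w"
      using z by (auto simp: w_def)
    ultimately have "?F w \<noteq> 0"
      by (simp add: mpoly_subst_dehomogenize[OF f(3)])
    moreover have "?F z = of_real a ^ d * ?F w"
      using z(3) mpoly_subst_scale[OF g, of complex_of_real "of_real a" w] by (simp add: w_def)
    ultimately show ?thesis
      using z(3) by simp
  qed
  show ?thesis
  proof (cases "a = 0")
    case False
    then show ?thesis
      using pos z by simp
  next
    case True
    have "f \<noteq> 0"
    proof
      assume "f = 0"
      then have "mpoly_subst complex_of_real z f = 0"
        by (simp add: mpoly_subst_def)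
      then show False
        using stable z(1) by (auto simp: stable_def mpoly_eval_complex_mpoly)
    qed
    then obtain x where x: "x n = 0" "?F x \<noteq> 0"
      using homogenization_nonzero_at_infinity[OF f] by blast
    \<comment> \<open>The line \<open>z + s * u\<close> joins \<open>z\<close> at
      \<open>s = 0\<close> to \<open>x\<close> at \<open>s = 1\<close>, and its last coordinate is
      constantly 0.\<close>
    define u where "u i = x i - z i" for i
    have "eventually (\<lambda>s. \<forall>j\<in>{..<n}. Im (z j + s * u j) > 0) (nhds 0)"
    proof (intro eventually_ball_finite ballI)
      fix j assume j: "j \<in> {..<n}"
      have "((\<lambda>s. Im (z j + s * u j)) \<longlongrightarrow> Im (z j + 0 * u j)) (nhds 0)"
        by (intro tendsto_intros filterlim_ident)
      then show "eventually (\<lambda>s. Im (z j + s * u j) > 0) (nhds 0)"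
        using z(1) j by (intro order_tendstoD(1)) auto
    qed simp
    then obtain r where r: "r > 0" "\<And>s j. norm s < r \<Longrightarrow> j < n \<Longrightarrow> Im (z j + s * u j) > 0"
      by (force simp: eventually_nhds_metric)
    \<comment> \<open>The same line with its last coordinate raised to \<open>b\<close>. For
      \<open>b > 0\<close> the case \<open>pos\<close> makes \<open>q b\<close> zero-free on the
      disc of radius \<open>r\<close>, which does not depend on \<open>b\<close>.\<close>
    define q where "q b = mpoly_subst (\<lambda>c. [:complex_of_real c:])
      (\<lambda>i. [:(z(n := of_real b)) i, u i:]) g" for b
    have q: "poly (q b) s = ?F (\<lambda>i. (z(n := of_real b)) i + s * u i)" for b s
      by (simp add: q_def poly_mpoly_subst)
    have un: "u n = 0"
      using x(1) z(2) True by (simp add: u_def)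
    \<comment> \<open>The constant is independent of \<open>b\<close>. As \<open>b\<close> tends to
      0 from the right, the inequality bounds the nonzero value at \<open>x\<close> by a multiple of
      the value at \<open>z\<close>.\<close>
    have "norm (poly (q b) 1) \<le> norm (poly (q b) 0) * (1 + norm (1::complex) / r) ^ d" if "b > 0" for b
    proof (rule norm_poly_le_of_zero_free[OF r(1)])
      show "degree (q b) \<le> d"
        unfolding q_def by (intro degree_mpoly_subst_le g) (auto intro: order.trans[OF degree_pCons_le])
      show "poly (q b) s \<noteq> 0" if "norm s < r" for s
        unfolding q using r(2)[OF that] \<open>b > 0\<close> un by (intro pos[of _ b]) auto
    qed
    then have "eventually (\<lambda>b. norm (poly (q b) 1) \<le> norm (poly (q b) 0) *
        (1 + norm (1::complex) / r) ^ d) (at_right 0)"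
      by (auto simp: eventually_at_right_less intro: eventually_at_right_less[THEN eventually_mono])
    moreover have "((\<lambda>b. poly (q b) s) \<longlongrightarrow> poly (q 0) s) (at_right 0)" for s
      unfolding q mpoly_subst_def
      by (intro tendsto_intros) (auto intro!: tendsto_eq_intros)
    ultimately have "norm (poly (q 0) 1) \<le> norm (poly (q 0) 0) * (1 + norm (1::complex) / r) ^ d"
      by (intro tendsto_le[OF _ tendsto_mult[OF tendsto_norm tendsto_const] tendsto_norm]) auto
    moreover have "z(n := 0) = z" "(\<lambda>i. z i + u i) = x"
      using z(2) True by (auto simp: u_def)
    ultimately show ?thesis
      using x(2) by (auto simp: q)
  qed
qed

theorem proposition1p1:
  fixes n d :: nat and f f\<^sub>H :: "real mpoly"
  assumes "f \<in> mpolys n"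
    and "total_degree f = d"
    and "is_homogenization n d f f\<^sub>H"
  shows "real_stable n (complex_mpoly f) \<longleftrightarrow>
    (\<forall>v :: nat \<Rightarrow> real. v n = 0 \<and> (\<forall>i<n. v i > 0) \<longrightarrow> hyperbolic f\<^sub>H v)"
proof
  let ?F = "\<lambda>z. mpoly_subst complex_of_real z f\<^sub>H"
  have hom: "homogeneous d f\<^sub>H" and vars: "f\<^sub>H \<in> mpolys (Suc n)"
    using assms(3) by (simp_all add: is_homogenization_def)
  {
    assume "real_stable n (complex_mpoly f)"
    then have upper: "?F z \<noteq> 0" if "\<And>j. j < n \<Longrightarrow> Im (z j) > 0" "z n = of_real a" "a \<ge> 0" for z a
      using homogenization_nonzero_upper[OF assms] that by (auto simp: real_stable_def)
    have upper': "?F z \<noteq> 0" if z: "\<And>j. j < n \<Longrightarrow> Im (z j) > 0" "z n = of_real a" for z a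
    proof (cases "a \<ge> 0")
      case False
      \<comment> \<open>The map keeps imaginary parts and turns \<open>a\<close> into
        \<open>- a\<close>. By homogeneity and real coefficients it changes the value only by
        conjugation and the factor \<open>(- 1) ^ d\<close>.\<close>
      have "?F (\<lambda>i. - 1 * cnj (z i)) \<noteq> 0"
        using z False by (intro upper[of _ "- a"]) auto
      then show ?thesis
        by (simp only: mpoly_subst_scale[OF hom] mpoly_subst_cnj) auto
    qed (use upper z in auto)
    show "\<forall>v. v n = 0 \<and> (\<forall>i<n. v i > 0) \<longrightarrow> hyperbolic f\<^sub>H v"
    proof (intro allI impI)
      fix v :: "nat \<Rightarrow> real" assume v: "v n = 0 \<and> (\<forall>i<n. v i > 0)"
      have "?F (\<lambda>i. \<i> * of_real (v i)) \<noteq> 0"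
        using v by (intro upper[of _ 0]) auto
      moreover have "?F (\<lambda>i. of_real (v i)) = of_real (mpoly_eval f\<^sub>H v)"
        using mpoly_subst_hom[of complex_of_real "\<lambda>c. c" v f\<^sub>H] by simp
      ultimately have "mpoly_eval f\<^sub>H v \<noteq> 0"
        by (simp add: mpoly_subst_scale[OF hom])
      moreover have "only_real_zeros (line_restriction f\<^sub>H \<alpha> v)" for \<alpha>
      proof -
        let ?L = "\<lambda>t i. of_real (\<alpha> i) + t * of_real (v i) :: complex"
        have L: "?F (?L t) \<noteq> 0" if "Im t > 0" for t
          using v that by (intro upper'[of _ "\<alpha> n"]) auto
        \<comment> \<open>As \<alpha>, \<open>v\<close> and the coefficients are real, zeros in
          \<open>t\<close> come in conjugate pairs.\<close>
        have "?F (?L t) \<noteq> 0" if "Im t < 0" for t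
          using L[of "cnj t"] mpoly_subst_cnj[of "?L t" f\<^sub>H] that by simp
        with L show ?thesis
          by (force simp: only_real_zeros_def poly_line_restriction complex_is_Real_iff)
      qed
      ultimately show "hyperbolic f\<^sub>H v"
        using hom by (auto simp: hyperbolic_def)
    qed
  next
    assume hyp: "\<forall>v. v n = 0 \<and> (\<forall>i<n. v i > 0) \<longrightarrow> hyperbolic f\<^sub>H v"
    have "mpoly_subst complex_of_real z f \<noteq> 0" if z: "\<forall>j<n. Im (z j) > 0" for z
    proof -
      \<comment> \<open>At \<open>t = \<i>\<close> this line passes through \<open>z\<close> with
        last coordinate 1. The values at indices above \<open>n\<close> are arbitrary, since the
        homogenization only involves the variables up to \<open>n\<close>.\<close>
      let ?v = "\<lambda>i. if i < n then Im (z i) else 0" and ?\<alpha> = "\<lambda>i. if i < n then Re (z i) else 1"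
      have "only_real_zeros (line_restriction f\<^sub>H ?\<alpha> ?v)"
        using hyp[rule_format, of ?v] z by (simp add: hyperbolic_def)
      then have "?F (\<lambda>i. of_real (?\<alpha> i) + \<i> * of_real (?v i)) \<noteq> 0"
        unfolding only_real_zeros_def poly_line_restriction by (force simp: complex_is_Real_iff)
      moreover have "?F (\<lambda>i. of_real (?\<alpha> i) + \<i> * of_real (?v i)) = ?F (z(n := 1))"
        by (intro mpoly_subst_cong[OF vars]) (auto simp: less_Suc_eq complex_eq_iff)
      ultimately show ?thesis
        by (simp add: mpoly_subst_dehomogenize[OF assms(3)])
    qed
    then have "stable n (complex_mpoly f)"
      by (simp add: stable_def mpoly_eval_complex_mpoly)
    then show "real_stable n (complex_mpoly f)"
      by (simp add: real_stable_def complex_mpoly_def map.rep_eq when_def)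
  }
qed

end
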